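(* For any proper metric space $(X,d)$ and any integer $n\geq 2$, the map $d_F\colon X^n\to[0,+\infty[$ defined by $$d_F(x_1,\ldots,x_n)=\min_{x\in X}\sum_{i=1}^n d(x_i,x)$$ is an $n$-distance on $X$.
   Context: Metric spaces are nonempty. A metric space is proper if every closed ball is compact (in a proper metric space the minimum above is attained). For $x_1,\ldots,x_n,z\in X$ and $i\in\{1,\ldots,n\}$, and a function $f\colon X^n\to[0,+\infty[$, $f(x_1,\ldots,x_n)_i^z$ denotes $f(x_1,\ldots,x_{i-1},z,x_{i+1},\ldots,x_n)$. An $n$-distance on a nonempty set $X$ (with $n\ge 2$ an integer) is a function $f\colon X^n\to[0,+\infty[$ such that: (i) $f(x_1,\ldots,x_n)\leq\sum_{i=1}^n f(x_1,\ldots,x_n)_i^z$ for all $x_1,\ldots,x_n,z\in X$; (ii) $f(x_1,\ldots,x_n)=f(x_{\pi(1)},\ldots,x_{\pi(n)})$ for all $x_1,\ldots,x_n\in X$ and all permutations $\pi$ of $\{1,\ldots,n\}$; (iii) $f(x_1,\ldots,x_n)=0$ if and only if $x_1=\cdots=x_n$. *)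

theory Defs
  imports "HOL-Analysis.Analysis"
begin

locale proper_metric_space = Metric_space X d for X :: "'a set" and d +
  assumes nonempty: "X \<noteq> {}"
    and compact_mcball: "\<And>x r. x \<in> X \<Longrightarrow> compactin mtopology (mcball x r)"

text \<open>A tuple $(x_1,\ldots,x_n)$ in $X^n$ is an element of \<open>{1..n} \<rightarrow>\<^sub>E X\<close>, that is, a function on
  \<open>{1..n}\<close> with the value \<open>undefined\<close> elsewhere. For \<open>i \<in> {1..n}\<close> the update \<open>x(i := z)\<close> replaces the
  \<open>i\<close>-th entry by \<open>z\<close>; for \<open>\<pi> permutes {1..n}\<close> the tuple \<open>x \<circ> \<pi>\<close> is again in \<open>{1..n} \<rightarrow>\<^sub>E X\<close>,
  since \<open>\<pi>\<close> is the identity outside \<open>{1..n}\<close>.\<close>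

definition n_distance :: "nat \<Rightarrow> 'a set \<Rightarrow> ((nat \<Rightarrow> 'a) \<Rightarrow> real) \<Rightarrow> bool" where
  "n_distance n X f \<longleftrightarrow>
     2 \<le> n \<and> X \<noteq> {} \<and>
     (\<forall>x \<in> {1..n} \<rightarrow>\<^sub>E X. 0 \<le> f x) \<and>
     (\<forall>x \<in> {1..n} \<rightarrow>\<^sub>E X. \<forall>z \<in> X. f x \<le> (\<Sum>i=1..n. f (x(i := z)))) \<and>
     (\<forall>x \<in> {1..n} \<rightarrow>\<^sub>E X. \<forall>\<pi>. \<pi> permutes {1..n} \<longrightarrow> f x = f (x \<circ> \<pi>)) \<and>
     (\<forall>x \<in> {1..n} \<rightarrow>\<^sub>E X. f x = 0 \<longleftrightarrow> (\<forall>i \<in> {1..n}. \<forall>j \<in> {1..n}. x i = x j))"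

text \<open>\<open>LEAST\<close> is the minimum of the set of values where that minimum exists (and is unspecified
  otherwise); \<open>Min\<close> is only meaningful for finite sets, and \<open>Inf\<close> need not be attained.\<close>

definition fermat_distance :: "nat \<Rightarrow> 'a set \<Rightarrow> ('a \<Rightarrow> 'a \<Rightarrow> real) \<Rightarrow> (nat \<Rightarrow> 'a) \<Rightarrow> real" where
  "fermat_distance n X d x = (LEAST s. s \<in> (\<lambda>z. \<Sum>i=1..n. d (x i) z) ` X)"

end

theory Submission
  imports Defs
begin

text \<open>The sum of distances \<open>z \<mapsto> d x\<^sub>1 z + \<dots> + d x\<^sub>n z\<close> attains its minimum because it is continuous
  and, outside the closed ball around \<open>x\<^sub>1\<close> whose radius is its value at \<open>x\<^sub>1\<close>, it exceeds
  that value; the ball is compact by properness.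

  The simplex inequality already holds with two of the summands on the right. Let \<open>a\<close> and
  \<open>b\<close> be minimizers (Fermat points) for the tuples in which \<open>x\<^sub>1\<close>, respectively \<open>x\<^sub>2\<close>, is replaced
  by \<open>z\<close>. Evaluating the distance sum of the original tuple at \<open>a\<close> differs from the value for the
  first modified tuple only in that \<open>d z a\<close> becomes \<open>d x\<^sub>1 a\<close>. By the triangle inequality along
  \<open>x\<^sub>1, b, z, a\<close> the excess is at most \<open>d x\<^sub>1 b + d z b\<close>, and both of these distances occur in
  the distance sum of the second modified tuple at \<open>b\<close>.

  Symmetry is the reindexing of a finite sum. The value is \<open>0\<close> exactly when some point is at
  distance \<open>0\<close> from all entries.\<close>

context Metric_space
begin

lemma continuous_map_sum_dist:
  assumes "x \<in> I \<rightarrow> M" and "finite I"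
  shows "continuous_map mtopology euclideanreal (\<lambda>z. \<Sum>i\<in>I. d (x i) z)"
proof (rule continuous_map_sum)
  fix i assume "i \<in> I"
  then have "x i \<in> M"
    using assms(1) by auto
  then have "continuous_map (mtopology_of (metric (M,d))) euclideanreal
               (\<lambda>z. mdist (metric (M,d)) (x i) z)"
    by (intro continuous_map_mdist) auto
  then show "continuous_map mtopology euclideanreal (d (x i))"
    by simp
qed (rule assms)

text \<open>Replacing entry \<open>p\<close> and entry \<open>q\<close> by \<open>z\<close> and summing distances to arbitrary points \<open>a\<close> and
  \<open>b\<close>: the distance \<open>d (x p) a\<close>, absent from the first sum, is bounded by the path through \<open>b\<close> and
  \<open>z\<close>, whose pieces occur in the two sums because \<open>p \<noteq> q\<close>.\<close>

lemma sum_dist_le_two_replacements: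
  assumes "finite I" "p \<in> I" "q \<in> I" "p \<noteq> q" "x \<in> I \<rightarrow> M" "z \<in> M" "a \<in> M" "b \<in> M"
  shows "(\<Sum>i\<in>I. d (x i) a) \<le> (\<Sum>i\<in>I. d ((x(p := z)) i) a) + (\<Sum>i\<in>I. d ((x(q := z)) i) b)"
proof -
  have xp: "x p \<in> M"
    using assms by auto
  have "(\<Sum>i\<in>I. d (x i) a) = d (x p) a + (\<Sum>i\<in>I - {p}. d (x i) a)"
    using assms by (simp add: sum.remove)
  moreover have "(\<Sum>i\<in>I. d ((x(p := z)) i) a) = d z a + (\<Sum>i\<in>I - {p}. d (x i) a)"
    using assms by (simp add: sum.remove)
  moreover have "d (x p) b + d z b = (\<Sum>i\<in>{p, q}. d ((x(q := z)) i) b)"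
    using \<open>p \<noteq> q\<close> by simp
  moreover have "(\<Sum>i\<in>{p, q}. d ((x(q := z)) i) b) \<le> (\<Sum>i\<in>I. d ((x(q := z)) i) b)"
    by (rule sum_mono2) (use assms in auto)
  moreover have "d (x p) a \<le> d (x p) b + d z b + d z a"
    using triangle[of "x p" b a] triangle[of b z a] commute[of b z] xp assms by auto
  ultimately show ?thesis
    by linarith
qed

end

context proper_metric_space
begin

lemma sum_dist_attains_min:
  assumes "finite I" "I \<noteq> {}" and x: "x \<in> I \<rightarrow> X"
  shows "\<exists>z\<in>X. \<forall>w\<in>X. (\<Sum>i\<in>I. d (x i) z) \<le> (\<Sum>i\<in>I. d (x i) w)"
proof -
  let ?g = "\<lambda>z. \<Sum>i\<in>I. d (x i) z"
  from \<open>I \<noteq> {}\<close> obtain p where p: "p \<in> I"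
    by auto
  then have xp: "x p \<in> X"
    using x by auto
  let ?B = "mcball (x p) (?g (x p))"
  have centre: "x p \<in> ?B"
    using xp by (simp add: sum_nonneg)
  have "compact (?g ` ?B)"
    unfolding compactin_euclidean_iff[symmetric]
    using image_compactin[OF compact_mcball[OF xp] continuous_map_sum_dist[OF x \<open>finite I\<close>]] .
  moreover have "?g ` ?B \<noteq> {}"
    using centre by blast
  ultimately obtain z where z: "z \<in> ?B" "\<And>w. w \<in> ?B \<Longrightarrow> ?g z \<le> ?g w"
    using compact_attains_inf[of "?g ` ?B"] by blast
  show ?thesis
  proof (intro bexI ballI)
    show "z \<in> X"
      using z by simp
  next
    fix w assume w: "w \<in> X"
    show "?g z \<le> ?g w"
    proof (cases "w \<in> ?B")
      case False
      have "?g z \<le> ?g (x p)"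
        by (rule z(2)[OF centre])
      also have "\<dots> \<le> d (x p) w"
        using False xp w by simp
      also have "\<dots> \<le> ?g w"
        using p \<open>finite I\<close> by (intro member_le_sum) auto
      finally show ?thesis .
    qed (rule z)
  qed
qed

lemma fermat_distance_attained:
  assumes "n \<ge> 1" and "x \<in> {1..n} \<rightarrow>\<^sub>E X"
  shows "\<exists>z\<in>X. fermat_distance n X d x = (\<Sum>i=1..n. d (x i) z) \<and>
           (\<forall>w\<in>X. fermat_distance n X d x \<le> (\<Sum>i=1..n. d (x i) w))"
proof -
  have "x \<in> {1..n} \<rightarrow> X"
    using assms(2) by (simp add: PiE_iff Pi_iff)
  then have "\<exists>z\<in>X. \<forall>w\<in>X. (\<Sum>i=1..n. d (x i) z) \<le> (\<Sum>i=1..n. d (x i) w)"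
    using assms(1) by (intro sum_dist_attains_min) simp_all
  then obtain z where z: "z \<in> X"
    "\<And>w. w \<in> X \<Longrightarrow> (\<Sum>i=1..n. d (x i) z) \<le> (\<Sum>i=1..n. d (x i) w)"
    by blast
  have "fermat_distance n X d x = (\<Sum>i=1..n. d (x i) z)"
    unfolding fermat_distance_def by (rule Least_equality) (use z in auto)
  with z show ?thesis
    by auto
qed

lemma fermat_distance_nonneg:
  assumes "n \<ge> 1" and "x \<in> {1..n} \<rightarrow>\<^sub>E X"
  shows "0 \<le> fermat_distance n X d x"
proof -
  obtain z where "fermat_distance n X d x = (\<Sum>i=1..n. d (x i) z)"
    using fermat_distance_attained[OF assms] by blast
  then show ?thesis
    by (simp add: sum_nonneg)
qed

lemma fermat_distance_simplex:
  assumes n: "n \<ge> 2" and x: "x \<in> {1..n} \<rightarrow>\<^sub>E X" and z: "z \<in> X"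
  shows "fermat_distance n X d x \<le> (\<Sum>i=1..n. fermat_distance n X d (x(i := z)))"
proof -
  let ?f = "fermat_distance n X d"
  have upd: "x(i := z) \<in> {1..n} \<rightarrow>\<^sub>E X" if "i \<in> {1..n}" for i
    using x z that by (auto simp: PiE_iff extensional_def)
  have n1: "n \<ge> 1" and I: "1 \<in> {1..n}" "2 \<in> {1..n}"
    using n by auto
  obtain a where a: "a \<in> X" "?f (x(1 := z)) = (\<Sum>i=1..n. d ((x(1 := z)) i) a)"
    using fermat_distance_attained[OF n1 upd[OF I(1)]] by blast
  obtain b where b: "b \<in> X" "?f (x(2 := z)) = (\<Sum>i=1..n. d ((x(2 := z)) i) b)"
    using fermat_distance_attained[OF n1 upd[OF I(2)]] by blast
  have "?f x \<le> (\<Sum>i=1..n. d (x i) a)"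
    using fermat_distance_attained[OF n1 x] a(1) by blast
  also have "\<dots> \<le> ?f (x(1 := z)) + ?f (x(2 := z))"
    unfolding a(2) b(2)
    by (rule sum_dist_le_two_replacements) (use I x z a(1) b(1) in auto)
  also have "\<dots> = (\<Sum>i\<in>{1, 2}. ?f (x(i := z)))"
    by simp
  also have "\<dots> \<le> (\<Sum>i=1..n. ?f (x(i := z)))"
    by (rule sum_mono2) (use I fermat_distance_nonneg[OF n1 upd] in auto)
  finally show ?thesis .
qed

lemma fermat_distance_eq_0_iff:
  assumes n: "n \<ge> 1" and x: "x \<in> {1..n} \<rightarrow>\<^sub>E X"
  shows "fermat_distance n X d x = 0 \<longleftrightarrow> (\<forall>i\<in>{1..n}. \<forall>j\<in>{1..n}. x i = x j)"
proof
  obtain z where z: "z \<in> X" "fermat_distance n X d x = (\<Sum>i=1..n. d (x i) z)"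
    using fermat_distance_attained[OF assms] by blast
  assume "fermat_distance n X d x = 0"
  then have "\<forall>i\<in>{1..n}. d (x i) z = 0"
    using z(2) by (simp add: sum_nonneg_eq_0_iff)
  then have "\<forall>i\<in>{1..n}. x i = z"
    using x z(1) by (auto simp: PiE_iff)
  then show "\<forall>i\<in>{1..n}. \<forall>j\<in>{1..n}. x i = x j"
    by simp
next
  assume eq: "\<forall>i\<in>{1..n}. \<forall>j\<in>{1..n}. x i = x j"
  have x1: "x 1 \<in> X"
    using n x by auto
  have "fermat_distance n X d x \<le> (\<Sum>i=1..n. d (x i) (x 1))"
    using fermat_distance_attained[OF assms] x1 by blast
  also have "\<dots> = 0"
  proof (rule sum.neutral, rule ballI)
    fix i assume "i \<in> {1..n}"
    moreover have "1 \<in> {1..n}"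
      using n by simp
    ultimately have "x i = x 1"
      using eq by blast
    then show "d (x i) (x 1) = 0"
      using x1 by simp
  qed
  finally show "fermat_distance n X d x = 0"
    using fermat_distance_nonneg[OF assms] by simp
qed

end

lemma fermat_distance_permute:
  assumes "\<pi> permutes {1..n}"
  shows "fermat_distance n X d (x \<circ> \<pi>) = fermat_distance n X d x"
proof -
  have "(\<Sum>i=1..n. d ((x \<circ> \<pi>) i) z) = (\<Sum>i=1..n. d (x i) z)" for z
    using sum.permute[OF assms, of "\<lambda>i. d (x i) z"] by (simp add: o_def)
  then show ?thesis
    by (simp add: fermat_distance_def)
qed

theorem proposition3p1:
  fixes X :: "'a set" and d :: "'a \<Rightarrow> 'a \<Rightarrow> real" and n :: nat
  assumes "proper_metric_space X d" and "n \<ge> 2"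
  shows "(\<forall>x \<in> {1..n} \<rightarrow>\<^sub>E X. \<exists>z \<in> X.
            fermat_distance n X d x = (\<Sum>i=1..n. d (x i) z) \<and>
            (\<forall>w \<in> X. fermat_distance n X d x \<le> (\<Sum>i=1..n. d (x i) w)))
       \<and> n_distance n X (fermat_distance n X d)"
proof -
  interpret proper_metric_space X d
    by (rule assms(1))
  have n1: "n \<ge> 1"
    using assms(2) by simp
  have "n_distance n X (fermat_distance n X d)"
    unfolding n_distance_def
    by (intro conjI ballI allI impI assms(2) nonempty fermat_distance_nonneg[OF n1]
        fermat_distance_simplex[OF assms(2)] fermat_distance_permute[symmetric]
        fermat_distance_eq_0_iff[OF n1])
  moreover have "\<exists>z \<in> X. fermat_distance n X d x = (\<Sum>i=1..n. d (x i) z) \<and>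
            (\<forall>w \<in> X. fermat_distance n X d x \<le> (\<Sum>i=1..n. d (x i) w))"
    if "x \<in> {1..n} \<rightarrow>\<^sub>E X" for x
    using fermat_distance_attained[OF n1 that] by blast
  ultimately show ?thesis
    by blast
qed

end
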